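(* Let $\mu,\nu\in\mathbb{N}$ (positive integers), let $\alpha,\beta,\gamma,\delta\in\mathbb{R}$, let $T=\operatorname{lcm}\{\mu,\nu\}$, and suppose that $\lambda(\Psi^{\mu,\nu}(T,0))\subseteq B(0,1)$, where $\Psi^{\mu,\nu}(T,0)\in\mathbb{R}^{2\times2}$ is the solution operator defined in the context. Then $o=(0,0)$ is a globally asymptotically stable solution of the $(\mu,\nu)$-asynchronous difference equation with parameters $\alpha,\beta,\gamma,\delta$, i.e., every solution $(x,y)$ of it satisfies $$\lim_{t\to\infty}x(t)=0=\lim_{t\to\infty}y(t).$$
   Context: For $\rho>0$ let $\mathbb{T}_\rho=\{0,\rho,2\rho,\ldots\}$. For $z:\mathbb{T}_\rho\to\mathbb{R}$ and $t\in\mathbb{T}_\rho$ put $\Delta_\rho z(t)=\frac{z(t+\rho)-z(t)}{\rho}$. For real $t\ge 0$ put $t^{*\rho}=\rho\lfloor t/\rho\rfloor=\max\{s\in\mathbb{T}_\rho: s\le t\}$. For $\mu,\nu>0$ and parameters $\alpha,\beta,\gamma,\delta\in\mathbb{R}$, the $(\mu,\nu)$-asynchronous difference equation is $$\Delta_\mu x(t)=\alpha x(t)+\beta y(t^{*\nu})\ \ (t\in\mathbb{T}_\mu),\qquad \Delta_\nu y(t)=\gamma x(t^{*\mu})+\delta y(t)\ \ (t\in\mathbb{T}_\nu).$$ A solution is a pair $(x,y)$ of functions $x:\mathbb{T}_\mu\to\mathbb{R}$, $y:\mathbb{T}_\nu\to\mathbb{R}$ satisfying both equations. The limits are taken along $t\in\mathbb{T}_\mu$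 for $x$ and along $t\in\mathbb{T}_\nu$ for $y$. Let $\mathbb{T}=\mathbb{T}_\mu\cup\mathbb{T}_\nu$; for $t\in\mathbb{T}$, $\sigma(t)=\min\{s\in\mathbb{T}: s>t\}$ is the successor of $t$ in $\mathbb{T}$. $\mathbf{1}_M$ denotes the indicator function of $M\subseteq\mathbb{R}$. For $t\in\mathbb{T}$ set $A(t)=A_{ijk\ell}$ with $(i,j,k,\ell)=\big(\mathbf{1}_{\mathbb{T}_\mu}(t),\mathbf{1}_{\mathbb{T}_\mu}(\sigma(t)),\mathbf{1}_{\mathbb{T}_\nu}(t),\mathbf{1}_{\mathbb{T}_\nu}(\sigma(t))\big)$ (always one of the nine quadruples below), where $$A_{1111}=\begin{pmatrix}1+\mu\alpha&0&\mu\beta&0\\1&0&0&0\\ \nu\gamma&0&1+\nu\delta&0\\0&0&1&0\end{pmatrix},\quad A_{1110}=\begin{pmatrix}1+\mu\alpha&0&\mu\beta&0\\1&0&0&0\\0&0&1&0\\0&0&1&0\end{pmatrix},\quad A_{1101}=\begin{pmatrix}1+\mu\alpha&0&0&\mu\beta\\1&0&0&0\\0&\nu\gamma&1+\nu\delta&0\\0&0&0&1\end{pmatrix},$$ $$A_{1100}=\begin{pmatrix}1+\mu\alpha&0&0&\mu\beta\\0&1&0&0\\0&0&1&0\\0&0&0&1\end{pmatrix},\quad A_{1011}=\begin{pmatrix}1&0&0&0\\1&0&0&0\\ \nu\gamma&0&1+\nu\delta&0\\0&0&1&0\end{pmatrix},\quad A_{1001}=\begin{pmatrix}1&0&0&0\\1&0&0&0\\0&\nu\gamma&1+\nu\delta&0\\0&0&0&1\end{pmatrix},$$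 $$A_{0111}=\begin{pmatrix}1+\mu\alpha&0&0&\mu\beta\\0&1&0&0\\0&\nu\gamma&1+\nu\delta&0\\0&0&1&0\end{pmatrix},\quad A_{0110}=\begin{pmatrix}1+\mu\alpha&0&0&\mu\beta\\0&1&0&0\\0&0&1&0\\0&0&1&0\end{pmatrix},\quad A_{0011}=\begin{pmatrix}1&0&0&0\\0&1&0&0\\0&\nu\gamma&1+\nu\delta&0\\0&0&0&1\end{pmatrix}.$$ Let $0=t_0<t_1<\dots<t_k=T$ be the elements of $\mathbb{T}\cap[0,T]$. The evolution operator is $\Phi^{\mu,\nu}(T,0)=A(t_{k-1})\cdots A(t_1)A(t_0)\in\mathbb{R}^{4\times4}$ and the solution operator is $$\Psi^{\mu,\nu}(T,0)=\begin{pmatrix}\Phi^{\mu,\nu}_{11}(T,0)&\Phi^{\mu,\nu}_{13}(T,0)\\ \Phi^{\mu,\nu}_{31}(T,0)&\Phi^{\mu,\nu}_{33}(T,0)\end{pmatrix}.$$ $\lambda(M)$ denotes the set of all (complex) eigenvalues of a matrix $M$, and $B(0,1)$ the open unit disc in $\mathbb{C}$. "Globally asymptotically stable" is used in the sense stated after "i.e." in the claim. *)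

theory Defs
  imports "HOL-Analysis.Elementary_Metric_Spaces" "Jordan_Normal_Form.Spectral_Radius"
begin

definition grid :: "real \<Rightarrow> real set" where
  "grid \<rho> = {real n * \<rho> | n. True}"

definition fdiff :: "real \<Rightarrow> (real \<Rightarrow> real) \<Rightarrow> real \<Rightarrow> real" where
  "fdiff \<rho> z t = (z (t + \<rho>) - z t) / \<rho>"

definition grid_floor :: "real \<Rightarrow> real \<Rightarrow> real" where
  "grid_floor \<rho> t = \<rho> * of_int \<lfloor>t / \<rho>\<rfloor>"

text \<open>
  Functions on a grid are rendered as total functions on the reals. For positive \<open>\<mu>\<close> and \<open>\<nu>\<close> the
  equations involve \<open>x\<close> only at points of \<open>grid \<mu>\<close> and \<open>y\<close> only at points of \<open>grid \<nu>\<close>, so the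
  values elsewhere are unconstrained and irrelevant.
\<close>
definition async_solution ::
    "real \<Rightarrow> real \<Rightarrow> real \<Rightarrow> real \<Rightarrow> real \<Rightarrow> real \<Rightarrow> (real \<Rightarrow> real) \<Rightarrow> (real \<Rightarrow> real) \<Rightarrow> bool" where
  "async_solution \<mu> \<nu> \<alpha> \<beta> \<gamma> \<delta> x y \<longleftrightarrow>
     (\<forall>t \<in> grid \<mu>. fdiff \<mu> x t = \<alpha> * x t + \<beta> * y (grid_floor \<nu> t)) \<and>
     (\<forall>t \<in> grid \<nu>. fdiff \<nu> y t = \<gamma> * x (grid_floor \<mu> t) + \<delta> * y t)"

definition grid_at_top :: "real \<Rightarrow> real filter" where
  "grid_at_top \<rho> = inf at_top (principal (grid \<rho>))"

definition joint_grid :: "real \<Rightarrow> real \<Rightarrow> real set" where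
  "joint_grid \<mu> \<nu> = grid \<mu> \<union> grid \<nu>"

definition joint_succ :: "real \<Rightarrow> real \<Rightarrow> real \<Rightarrow> real" where
  "joint_succ \<mu> \<nu> t = (LEAST s. s \<in> joint_grid \<mu> \<nu> \<and> t < s)"

text \<open>
  The matrices \<open>A\<^sub>i\<^sub>j\<^sub>k\<^sub>l\<close>, with the indices 1 and 0 read as \<open>True\<close> and \<open>False\<close>. The remaining seven
  quadruples cannot occur, since \<open>t\<close> and its successor each lie in one of the two grids.
\<close>
fun async_matrix ::
    "real \<Rightarrow> real \<Rightarrow> real \<Rightarrow> real \<Rightarrow> real \<Rightarrow> real \<Rightarrow> bool \<Rightarrow> bool \<Rightarrow> bool \<Rightarrow> bool \<Rightarrow> real mat" where
  "async_matrix \<mu> \<nu> \<alpha> \<beta> \<gamma> \<delta> True True True True = mat_of_rows_list 4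
     [[1 + \<mu> * \<alpha>, 0, \<mu> * \<beta>, 0],
      [1, 0, 0, 0],
      [\<nu> * \<gamma>, 0, 1 + \<nu> * \<delta>, 0],
      [0, 0, 1, 0]]"
| "async_matrix \<mu> \<nu> \<alpha> \<beta> \<gamma> \<delta> True True True False = mat_of_rows_list 4
     [[1 + \<mu> * \<alpha>, 0, \<mu> * \<beta>, 0],
      [1, 0, 0, 0],
      [0, 0, 1, 0],
      [0, 0, 1, 0]]"
| "async_matrix \<mu> \<nu> \<alpha> \<beta> \<gamma> \<delta> True True False True = mat_of_rows_list 4
     [[1 + \<mu> * \<alpha>, 0, 0, \<mu> * \<beta>],
      [1, 0, 0, 0],
      [0, \<nu> * \<gamma>, 1 + \<nu> * \<delta>, 0],
      [0, 0, 0, 1]]"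
| "async_matrix \<mu> \<nu> \<alpha> \<beta> \<gamma> \<delta> True True False False = mat_of_rows_list 4
     [[1 + \<mu> * \<alpha>, 0, 0, \<mu> * \<beta>],
      [0, 1, 0, 0],
      [0, 0, 1, 0],
      [0, 0, 0, 1]]"
| "async_matrix \<mu> \<nu> \<alpha> \<beta> \<gamma> \<delta> True False True True = mat_of_rows_list 4
     [[1, 0, 0, 0],
      [1, 0, 0, 0],
      [\<nu> * \<gamma>, 0, 1 + \<nu> * \<delta>, 0],
      [0, 0, 1, 0]]"
| "async_matrix \<mu> \<nu> \<alpha> \<beta> \<gamma> \<delta> True False False True = mat_of_rows_list 4
     [[1, 0, 0, 0],
      [1, 0, 0, 0],
      [0, \<nu> * \<gamma>, 1 + \<nu> * \<delta>, 0],
      [0, 0, 0, 1]]"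
| "async_matrix \<mu> \<nu> \<alpha> \<beta> \<gamma> \<delta> False True True True = mat_of_rows_list 4
     [[1 + \<mu> * \<alpha>, 0, 0, \<mu> * \<beta>],
      [0, 1, 0, 0],
      [0, \<nu> * \<gamma>, 1 + \<nu> * \<delta>, 0],
      [0, 0, 1, 0]]"
| "async_matrix \<mu> \<nu> \<alpha> \<beta> \<gamma> \<delta> False True True False = mat_of_rows_list 4
     [[1 + \<mu> * \<alpha>, 0, 0, \<mu> * \<beta>],
      [0, 1, 0, 0],
      [0, 0, 1, 0],
      [0, 0, 1, 0]]"
| "async_matrix \<mu> \<nu> \<alpha> \<beta> \<gamma> \<delta> False False True True = mat_of_rows_list 4
     [[1, 0, 0, 0],
      [0, 1, 0, 0],
      [0, \<nu> * \<gamma>, 1 + \<nu> * \<delta>, 0],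
      [0, 0, 0, 1]]"
| "async_matrix \<mu> \<nu> \<alpha> \<beta> \<gamma> \<delta> _ _ _ _ = undefined"

definition async_matrix_at ::
    "real \<Rightarrow> real \<Rightarrow> real \<Rightarrow> real \<Rightarrow> real \<Rightarrow> real \<Rightarrow> real \<Rightarrow> real mat" where
  "async_matrix_at \<mu> \<nu> \<alpha> \<beta> \<gamma> \<delta> t = async_matrix \<mu> \<nu> \<alpha> \<beta> \<gamma> \<delta>
     (t \<in> grid \<mu>) (joint_succ \<mu> \<nu> t \<in> grid \<mu>) (t \<in> grid \<nu>) (joint_succ \<mu> \<nu> t \<in> grid \<nu>)"

lemma finite_joint_grid_below:
  assumes "\<mu> > 0" "\<nu> > 0"
  shows "finite (joint_grid \<mu> \<nu> \<inter> {0..<b})"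
proof -
  have "finite (grid \<rho> \<inter> {0..<b})" if "\<rho> > 0" for \<rho>
  proof (rule finite_subset)
    show "grid \<rho> \<inter> {0..<b} \<subseteq> (\<lambda>n. real n * \<rho>) ` {..nat \<lceil>b / \<rho>\<rceil>}"
    proof
      fix t assume "t \<in> grid \<rho> \<inter> {0..<b}"
      then obtain n where n: "t = real n * \<rho>" "real n * \<rho> < b"
        by (auto simp: grid_def)
      then have "real n < b / \<rho>"
        using that by (simp add: pos_less_divide_eq)
      then have "n \<le> nat \<lceil>b / \<rho>\<rceil>"
        by linarith
      then show "t \<in> (\<lambda>n. real n * \<rho>) ` {..nat \<lceil>b / \<rho>\<rceil>}"
        using n by auto
    qed
  qed simp
  then show ?thesis
    using assms by (simp add: joint_grid_def Int_Un_distrib2)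
qed

text \<open>
  The sorted list of the points below \<open>T\<close> is \<open>t\<^sub>0 < \<dots> < t\<^sub>k\<^sub>-\<^sub>1\<close> when \<open>t\<^sub>k = T\<close> is itself a point of the
  joint grid. The fold multiplies each new factor from the left.
\<close>
definition evolution_op ::
    "real \<Rightarrow> real \<Rightarrow> real \<Rightarrow> real \<Rightarrow> real \<Rightarrow> real \<Rightarrow> real \<Rightarrow> real mat" where
  "evolution_op \<mu> \<nu> \<alpha> \<beta> \<gamma> \<delta> T =
     foldl (\<lambda>P t. async_matrix_at \<mu> \<nu> \<alpha> \<beta> \<gamma> \<delta> t * P) (1\<^sub>m 4)
       (sorted_list_of_set (joint_grid \<mu> \<nu> \<inter> {0..<T}))"

text \<open>Matrix indices start at 0 here, so rows and columns 1 and 3 become 0 and 2.\<close>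
definition solution_op ::
    "real \<Rightarrow> real \<Rightarrow> real \<Rightarrow> real \<Rightarrow> real \<Rightarrow> real \<Rightarrow> real \<Rightarrow> real mat" where
  "solution_op \<mu> \<nu> \<alpha> \<beta> \<gamma> \<delta> T =
     (let \<Phi> = evolution_op \<mu> \<nu> \<alpha> \<beta> \<gamma> \<delta> T in
      mat_of_rows_list 2
        [[\<Phi> $$ (0, 0), \<Phi> $$ (0, 2)],
         [\<Phi> $$ (2, 0), \<Phi> $$ (2, 2)]])"

definition zero_globally_asymptotically_stable ::
    "real \<Rightarrow> real \<Rightarrow> real \<Rightarrow> real \<Rightarrow> real \<Rightarrow> real \<Rightarrow> bool" where
  "zero_globally_asymptotically_stable \<mu> \<nu> \<alpha> \<beta> \<gamma> \<delta> \<longleftrightarrow>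
     async_solution \<mu> \<nu> \<alpha> \<beta> \<gamma> \<delta> (\<lambda>_. 0) (\<lambda>_. 0) \<and>
     (\<forall>x y. async_solution \<mu> \<nu> \<alpha> \<beta> \<gamma> \<delta> x y \<longrightarrow>
        (x \<longlongrightarrow> 0) (grid_at_top \<mu>) \<and> (y \<longlongrightarrow> 0) (grid_at_top \<nu>))"

end

theory Submission
  imports Defs
begin

text \<open>
  The product of the matrices up to time \<open>T\<close> transports the values of any solution from 0 to \<open>T\<close>, and
  the equation is invariant under translation by \<open>T\<close>, a common multiple of the two step sizes.
  Hence the pairs \<open>(x (k T), y (k T))\<close> are the orbit of a linear map whose eigenvalues lie in the
  open unit disc, so they tend to 0. Within one period the values are bounded by a fixed multiple
  of those at its beginning.
\<close>

section \<open>Powers of a matrix with spectrum in the open unit disc\<close>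

lemma eigenvalue_smult_mat:
  fixes A :: "'a :: field mat"
  assumes "A \<in> carrier_mat n n" "c \<noteq> 0" "eigenvalue (c \<cdot>\<^sub>m A) k"
  shows "eigenvalue A (k / c)"
proof -
  obtain v where v: "v \<in> carrier_vec n" "v \<noteq> 0\<^sub>v n" "(c \<cdot>\<^sub>m A) *\<^sub>v v = k \<cdot>\<^sub>v v"
    using assms by (auto simp: eigenvalue_def eigenvector_def)
  have "A *\<^sub>v v = (k / c) \<cdot>\<^sub>v v"
  proof (rule eq_vecI)
    fix i assume i: "i < dim_vec ((k / c) \<cdot>\<^sub>v v)"
    have "c * (A *\<^sub>v v) $ i = ((c \<cdot>\<^sub>m A) *\<^sub>v v) $ i"
      using i v(1) assms(1) by (simp add: row_smult)
    also have "\<dots> = k * v $ i"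
      using i v by simp
    finally show "(A *\<^sub>v v) $ i = ((k / c) \<cdot>\<^sub>v v) $ i"
      using i assms(2) by (simp add: field_simps)
  qed (use assms(1) v(1) in auto)
  then show ?thesis
    using assms(1) v unfolding eigenvalue_def eigenvector_def by auto
qed

lemma pow_mat_smult:
  fixes A :: "'a :: comm_semiring_1 mat"
  assumes "A \<in> carrier_mat n n"
  shows "(c \<cdot>\<^sub>m A) ^\<^sub>m k = c ^ k \<cdot>\<^sub>m (A ^\<^sub>m k)"
proof (induction k)
  case 0
  then show ?case using assms by (auto intro!: eq_matI)
next
  case (Suc k)
  have "(c ^ k \<cdot>\<^sub>m (A ^\<^sub>m k)) * (c \<cdot>\<^sub>m A) = c \<cdot>\<^sub>m (c ^ k \<cdot>\<^sub>m (A ^\<^sub>m k) * A)"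
    using assms by (intro mult_smult_distrib[of _ n n _ n]) auto
  also have "c ^ k \<cdot>\<^sub>m (A ^\<^sub>m k) * A = c ^ k \<cdot>\<^sub>m (A ^\<^sub>m k * A)"
    using assms by (intro mult_smult_assoc_mat[of _ n n _ n]) auto
  finally show ?case
    using Suc by (auto intro!: eq_matI simp: mult.assoc)
qed

text \<open>Rescaling by a number strictly between the spectral radius and 1 turns the boundedness of
  the powers into geometric decay.\<close>
lemma pow_mat_tendsto_zero:
  fixes A :: "complex mat"
  assumes A: "A \<in> carrier_mat n n" and sp: "spectrum A \<subseteq> ball 0 1" and ij: "i < n" "j < n"
  shows "(\<lambda>k. (A ^\<^sub>m k) $$ (i, j)) \<longlonglongrightarrow> 0"
proof -
  have n: "n > 0" using ij by simp
  define s where "s = spectral_radius A"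
  obtain e where e: "e \<in> spectrum A" "s = norm e"
    using spectral_radius_mem_max(1)[OF A n] by (auto simp: s_def)
  then have s: "0 \<le> s" "s < 1" using sp by auto
  \<comment> \<open>The midpoint of \<open>s\<close> and 1 is positive even when
    \<open>s = 0\<close>, so division by \<open>r\<close> is possible.\<close>
  define r where "r = (1 + s) / 2"
  have r: "0 < r" "r < 1" "s < r" using s by (auto simp: r_def)
  define B where "B = complex_of_real (1 / r) \<cdot>\<^sub>m A"
  have B: "B \<in> carrier_mat n n" using A by (simp add: B_def)
  obtain b where b: "b \<in> spectrum B" "spectral_radius B = norm b"
    using spectral_radius_mem_max(1)[OF B n] by auto
  \<comment> \<open>Since \<open>b / (1 / r) = b * r\<close>, an eigenvalue \<open>b\<close> of
    \<open>B\<close> yields the eigenvalue \<open>b * r\<close> of \<open>A\<close>, whence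
    \<open>norm b * r \<le> s < r\<close>.\<close>
  have "b / complex_of_real (1 / r) \<in> spectrum A"
    using eigenvalue_smult_mat[OF A, of "complex_of_real (1 / r)" b] b(1) r
    by (simp add: spectrum_def B_def)
  then have "norm (b / complex_of_real (1 / r)) \<le> s"
    unfolding s_def by (intro spectral_radius_mem_max(2)[OF A n]) auto
  then have "norm b * r \<le> s"
    using r by (simp add: norm_divide norm_mult)
  then have "norm b * r < 1 * r"
    using r by linarith
  then have "spectral_radius B < 1" using r(1) b(2) by simp
  then obtain c where c: "\<And>k. norm_bound (B ^\<^sub>m k) c"
    using spectral_radius_jnf_norm_bound_less_1_upper_triangular[OF B] by blast
  have AB: "A = complex_of_real r \<cdot>\<^sub>m B"
    using r A unfolding B_def by (auto intro!: eq_matI)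
  have bound: "norm ((A ^\<^sub>m k) $$ (i, j)) \<le> r ^ k * c" for k
  proof -
    have d: "B ^\<^sub>m k \<in> carrier_mat n n" using B by simp
    have "(A ^\<^sub>m k) $$ (i, j) = complex_of_real r ^ k * (B ^\<^sub>m k) $$ (i, j)"
      unfolding AB pow_mat_smult[OF B] using carrier_matD[OF B] ij by simp
    moreover have "norm ((B ^\<^sub>m k) $$ (i, j)) \<le> c"
      using c[of k] carrier_matD[OF d] ij unfolding norm_bound_def by metis
    ultimately show ?thesis using r by (simp add: norm_mult norm_power mult_left_mono)
  qed
  have "(\<lambda>k. r ^ k * c) \<longlonglongrightarrow> 0"
    using tendsto_mult_right[OF LIMSEQ_realpow_zero[of r], of c] r by simp
  then show ?thesis
    by (rule tendsto_0_le[where K = 1])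
      (use order_trans[OF bound abs_ge_self] in \<open>auto intro!: always_eventually\<close>)
qed

text \<open>Iterating the recurrence makes each coordinate of \<open>u k\<close> a fixed finite
  combination of entries of the \<open>k\<close>-th power of \<open>A\<close>. These entries decay
  because the embedding of the reals into the complex numbers commutes with matrix powers and
  reflects convergence.\<close>

lemma linear_recurrence_tendsto_zero:
  fixes A :: "real mat" and u :: "nat \<Rightarrow> real vec"
  assumes A: "A \<in> carrier_mat n n"
    and sp: "spectrum (map_mat complex_of_real A) \<subseteq> ball 0 1"
    and u: "\<And>k. u k \<in> carrier_vec n" "\<And>k. u (Suc k) = A *\<^sub>v u k"
    and i: "i < n"
  shows "(\<lambda>k. u k $ i) \<longlonglongrightarrow> 0"
proof -
  have uk: "u (j + k) = A ^\<^sub>m k *\<^sub>v u j" for j k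
  proof (induction k arbitrary: j)
    case 0
    then show ?case using A u(1) by simp
  next
    case (Suc k)
    have "A ^\<^sub>m Suc k *\<^sub>v u j = A ^\<^sub>m k *\<^sub>v (A *\<^sub>v u j)"
      using A u(1) by (simp add: assoc_mult_mat_vec[of _ n n _ n])
    then show ?case using Suc[of "Suc j"] by (simp add: u(2))
  qed
  have entry: "(\<lambda>k. (A ^\<^sub>m k) $$ (i, j)) \<longlonglongrightarrow> 0" if "j < n" for j
  proof -
    have "(map_mat complex_of_real A ^\<^sub>m k) $$ (i, j) = complex_of_real ((A ^\<^sub>m k) $$ (i, j))" for k
      unfolding of_real_hom.mat_hom_pow[OF A, symmetric]
      using carrier_matD[OF pow_carrier_mat[OF A, of k]] i that by (metis index_map_mat(1))
    then have "(\<lambda>k. complex_of_real ((A ^\<^sub>m k) $$ (i, j))) \<longlonglongrightarrow> complex_of_real 0"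
      using pow_mat_tendsto_zero[of "map_mat complex_of_real A" n i j] A sp i that by simp
    then show ?thesis by (simp only: tendsto_of_real_iff)
  qed
  have "u k $ i = (\<Sum>j<n. (A ^\<^sub>m k) $$ (i, j) * u 0 $ j)" for k
    using uk[of 0 k] A u(1)[of 0] i
    by (auto simp: scalar_prod_def lessThan_atLeast0 intro!: sum.cong)
  moreover have "(\<lambda>k. \<Sum>j<n. (A ^\<^sub>m k) $$ (i, j) * u 0 $ j) \<longlonglongrightarrow> (\<Sum>j<n. 0 * u 0 $ j)"
    by (intro tendsto_sum tendsto_mult_right entry) auto
  ultimately show ?thesis by simp
qed

section \<open>The equation on integer times\<close>

definition grid_floor_nat :: "nat \<Rightarrow> nat \<Rightarrow> nat" where
  "grid_floor_nat \<rho> n = \<rho> * (n div \<rho>)"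

text \<open>One half of the system, along integer times. The other half is the same predicate with the
  roles of \<open>x\<close> and \<open>y\<close> exchanged.\<close>

definition async_rec ::
    "nat \<Rightarrow> nat \<Rightarrow> real \<Rightarrow> real \<Rightarrow> (nat \<Rightarrow> real) \<Rightarrow> (nat \<Rightarrow> real) \<Rightarrow> bool" where
  "async_rec \<mu> \<nu> \<alpha> \<beta> X Y \<longleftrightarrow>
     (\<forall>n. \<mu> dvd n \<longrightarrow>
        X (n + \<mu>) = (1 + real \<mu> * \<alpha>) * X n + real \<mu> * \<beta> * Y (grid_floor_nat \<nu> n))"

lemma grid_floor_nat_le: "grid_floor_nat \<rho> n \<le> n"
  by (simp add: grid_floor_nat_def)

lemma dvd_grid_floor_nat: "\<rho> dvd grid_floor_nat \<rho> n"
  by (simp add: grid_floor_nat_def)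

lemma grid_floor_nat_eq: "\<rho> dvd n \<Longrightarrow> grid_floor_nat \<rho> n = n"
  by (simp add: grid_floor_nat_def)

lemma less_grid_floor_nat_add: "\<rho> > 0 \<Longrightarrow> n < grid_floor_nat \<rho> n + \<rho>"
  using dividend_less_times_div[of \<rho> n] by (simp add: grid_floor_nat_def)

text \<open>A multiple of \<open>\<rho>\<close> passes through the division unchanged; the
  translation invariance of the system rests on this. For \<open>\<rho> = 0\<close>, divisibility
  forces \<open>T = 0\<close> and both sides are 0.\<close>

lemma grid_floor_nat_add: "\<rho> dvd T \<Longrightarrow> grid_floor_nat \<rho> (T + n) = T + grid_floor_nat \<rho> n"
  by (auto simp: grid_floor_nat_def elim!: dvdE) (cases "\<rho> = 0"; simp add: algebra_simps)

lemma grid_floor_nat_unique: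
  assumes "\<rho> dvd k" "k \<le> n" "n < k + \<rho>"
  shows "grid_floor_nat \<rho> n = k"
proof -
  have "n = k + (n - k)" "n - k < \<rho>" using assms by auto
  moreover have "grid_floor_nat \<rho> (n - k) = 0"
    using \<open>n - k < \<rho>\<close> by (simp add: grid_floor_nat_def)
  ultimately show ?thesis using grid_floor_nat_add[OF assms(1), of "n - k"] by simp
qed

lemma grid_floor_of_nat: "\<rho> > 0 \<Longrightarrow> grid_floor (real \<rho>) (real n) = real (grid_floor_nat \<rho> n)"
  by (simp add: grid_floor_def grid_floor_nat_def floor_divide_of_nat_eq)

lemma real_mem_grid: "real n \<in> grid (real \<rho>) \<longleftrightarrow> \<rho> dvd n"
  by (auto simp: grid_def simp flip: of_nat_mult)

lemma grid_real: "grid (real \<rho>) = real ` {n. \<rho> dvd n}"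
  by (auto simp: grid_def image_iff dvd_def mult.commute simp flip: of_nat_mult)

lemma fdiff_eq_iff:
  "\<rho> \<noteq> 0 \<Longrightarrow> fdiff \<rho> z t = a * z t + w \<longleftrightarrow> z (t + \<rho>) = (1 + \<rho> * a) * z t + \<rho> * w"
  by (simp add: fdiff_def field_simps)

text \<open>With integer step sizes every argument in the equations is a natural number, and
  clearing denominators turns each difference quotient into a recurrence. The second equation is the
  first with the grids and the functions exchanged, so \<open>\<delta>\<close> takes the place of
  \<open>\<alpha>\<close> and \<open>\<gamma>\<close> that of \<open>\<beta>\<close>.\<close>

lemma async_solution_nat:
  assumes "\<mu> > 0" "\<nu> > 0"
  shows "async_solution (real \<mu>) (real \<nu>) \<alpha> \<beta> \<gamma> \<delta> x y \<longleftrightarrow>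
    async_rec \<mu> \<nu> \<alpha> \<beta> (\<lambda>n. x (real n)) (\<lambda>n. y (real n)) \<and>
    async_rec \<nu> \<mu> \<delta> \<gamma> (\<lambda>n. y (real n)) (\<lambda>n. x (real n))"
  using assms
  by (simp add: async_solution_def async_rec_def grid_real grid_floor_of_nat fdiff_eq_iff
      add.commute[of "\<gamma> * _"] algebra_simps)

text \<open>Floors commute with a shift by a common multiple, so facts about the start 0 can be
  reused at the start of every period.\<close>

lemma async_rec_shift:
  assumes "async_rec \<mu> \<nu> \<alpha> \<beta> X Y" "\<mu> dvd T" "\<nu> dvd T"
  shows "async_rec \<mu> \<nu> \<alpha> \<beta> (\<lambda>n. X (T + n)) (\<lambda>n. Y (T + n))"
  using assms by (auto simp: async_rec_def grid_floor_nat_add add.assoc[symmetric])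

section \<open>Growth over finitely many steps\<close>

lemma grid_floor_nat_Suc:
  assumes "\<rho> > 0"
  shows "grid_floor_nat \<rho> (Suc n) =
    (if \<rho> dvd Suc n then grid_floor_nat \<rho> n + \<rho> else grid_floor_nat \<rho> n)"
  using assms by (auto simp: grid_floor_nat_def div_Suc mod_eq_0_iff_dvd)

lemma async_rec_floor:
  assumes "async_rec \<mu> \<nu> \<alpha> \<beta> X Y"
  shows "X (grid_floor_nat \<mu> n + \<mu>) = (1 + real \<mu> * \<alpha>) * X (grid_floor_nat \<mu> n)
    + real \<mu> * \<beta> * Y (grid_floor_nat \<nu> (grid_floor_nat \<mu> n))"
  using assms dvd_grid_floor_nat by (simp add: async_rec_def)

text \<open>Either the floor stays in place, which the summand 1 of the factor covers, or one step
  of the recurrence is taken. That step reads \<open>Y\<close> at the earlier time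
  \<open>grid_floor_nat \<mu> n\<close>, hence a bound over all \<open>s \<le> n\<close>.\<close>

lemma async_rec_bound_step:
  assumes "\<mu> > 0" "async_rec \<mu> \<nu> \<alpha> \<beta> X Y"
    and M: "\<And>s. s \<le> n \<Longrightarrow> \<bar>X (grid_floor_nat \<mu> s)\<bar> \<le> M"
      "\<And>s. s \<le> n \<Longrightarrow> \<bar>Y (grid_floor_nat \<nu> s)\<bar> \<le> M"
  shows "\<bar>X (grid_floor_nat \<mu> (Suc n))\<bar> \<le> (1 + \<bar>1 + real \<mu> * \<alpha>\<bar> + \<bar>real \<mu> * \<beta>\<bar>) * M"
proof -
  have "\<bar>X (grid_floor_nat \<mu> n)\<bar> \<le> M" "\<bar>Y (grid_floor_nat \<nu> (grid_floor_nat \<mu> n))\<bar> \<le> M"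
    using M grid_floor_nat_le by auto
  then have "\<bar>(1 + real \<mu> * \<alpha>) * X (grid_floor_nat \<mu> n)
      + real \<mu> * \<beta> * Y (grid_floor_nat \<nu> (grid_floor_nat \<mu> n))\<bar>
      \<le> \<bar>1 + real \<mu> * \<alpha>\<bar> * M + \<bar>real \<mu> * \<beta>\<bar> * M"
    by (intro order_trans[OF abs_triangle_ineq] add_mono)
      (simp_all add: abs_mult mult_left_mono del: abs_of_nat)
  moreover have "0 \<le> M" "0 \<le> \<bar>1 + real \<mu> * \<alpha>\<bar> * M" "0 \<le> \<bar>real \<mu> * \<beta>\<bar> * M"
    using \<open>\<bar>X (grid_floor_nat \<mu> n)\<bar> \<le> M\<close> by auto
  ultimately show ?thesis
    using \<open>\<bar>X (grid_floor_nat \<mu> n)\<bar> \<le> M\<close> async_rec_floor[OF assms(2), of n]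
    unfolding grid_floor_nat_Suc[OF assms(1)] distrib_right by auto
qed

text \<open>The constant is chosen before \<open>X\<close> and \<open>Y\<close>, so that one
  \<open>C\<close> serves all translates of a solution at once.\<close>

lemma async_rec_bounded:
  assumes "\<mu> > 0" "\<nu> > 0"
  shows "\<exists>C \<ge> 0. \<forall>X Y. async_rec \<mu> \<nu> \<alpha> \<beta> X Y \<longrightarrow> async_rec \<nu> \<mu> \<delta> \<gamma> Y X \<longrightarrow>
    (\<forall>s \<le> n. \<bar>X (grid_floor_nat \<mu> s)\<bar> \<le> C * (\<bar>X 0\<bar> + \<bar>Y 0\<bar>) \<and>
      \<bar>Y (grid_floor_nat \<nu> s)\<bar> \<le> C * (\<bar>X 0\<bar> + \<bar>Y 0\<bar>))"
proof (induction n)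
  case 0
  then show ?case by (intro exI[of _ 1]) (auto simp: grid_floor_nat_def)
next
  case (Suc n)
  then obtain C where C: "C \<ge> 0" "\<And>X Y s. async_rec \<mu> \<nu> \<alpha> \<beta> X Y \<Longrightarrow> async_rec \<nu> \<mu> \<delta> \<gamma> Y X \<Longrightarrow> s \<le> n \<Longrightarrow>
      \<bar>X (grid_floor_nat \<mu> s)\<bar> \<le> C * (\<bar>X 0\<bar> + \<bar>Y 0\<bar>) \<and>
      \<bar>Y (grid_floor_nat \<nu> s)\<bar> \<le> C * (\<bar>X 0\<bar> + \<bar>Y 0\<bar>)"
    by metis
  define p where "p = \<bar>1 + real \<mu> * \<alpha>\<bar> + \<bar>real \<mu> * \<beta>\<bar>"
  define q where "q = \<bar>1 + real \<nu> * \<delta>\<bar> + \<bar>real \<nu> * \<gamma>\<bar>"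
  have pq: "0 \<le> p" "0 \<le> q" by (auto simp: p_def q_def)
  \<comment> \<open>Here \<open>k\<close> is the growth factor of the case at hand: 1 for old times,
    \<open>1 + p\<close> for a new value of \<open>X\<close>, \<open>1 + q\<close> for a new value
    of \<open>Y\<close>.\<close>
  have grow: "z \<le> (1 + p + q) * C * w"
    if "z \<le> k * (C * w)" "k \<le> 1 + p + q" "0 \<le> w" for z k w :: real
  proof -
    have "k * (C * w) \<le> (1 + p + q) * (C * w)"
      using that C(1) by (intro mult_right_mono) auto
    with that(1) show ?thesis by (simp add: mult.assoc)
  qed
  show ?case
  proof (intro exI[of _ "(1 + p + q) * C"] conjI allI impI)
    show "0 \<le> (1 + p + q) * C" using C(1) pq by simp
    fix X Y s
    assume X: "async_rec \<mu> \<nu> \<alpha> \<beta> X Y" and Y: "async_rec \<nu> \<mu> \<delta> \<gamma> Y X" and s: "s \<le> Suc n"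
    note b = C(2)[OF X Y]
    note bx = b[THEN conjunct1] and bY = b[THEN conjunct2]
    have w: "0 \<le> \<bar>X 0\<bar> + \<bar>Y 0\<bar>" by simp
    show "\<bar>X (grid_floor_nat \<mu> s)\<bar> \<le> (1 + p + q) * C * (\<bar>X 0\<bar> + \<bar>Y 0\<bar>)"
    proof (cases "s \<le> n")
      case True
      then show ?thesis using bx[OF True] pq by (intro grow[OF _ _ w, of _ 1]) auto
    next
      case False
      then have "s = Suc n" using s by simp
      then show ?thesis
        using async_rec_bound_step[OF assms(1) X bx bY] pq
        by (intro grow[OF _ _ w, of _ "1 + p"]) (auto simp: p_def add.assoc)
    qed
    show "\<bar>Y (grid_floor_nat \<nu> s)\<bar> \<le> (1 + p + q) * C * (\<bar>X 0\<bar> + \<bar>Y 0\<bar>)"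
    proof (cases "s \<le> n")
      case True
      then show ?thesis using bY[OF True] pq by (intro grow[OF _ _ w, of _ 1]) auto
    next
      case False
      then have "s = Suc n" using s by simp
      then show ?thesis
        using async_rec_bound_step[OF assms(2) Y bY bx] pq
        by (intro grow[OF _ _ w, of _ "1 + q"]) (auto simp: q_def add.assoc)
    qed
  qed
qed

section \<open>Successors in the joint grid\<close>

text \<open>The search includes \<open>n\<close> itself: a grid point is its own
  \<open>next_grid\<close>, and its proper successor is obtained from \<open>Suc n\<close>. This
  permits induction over all natural numbers instead of over grid points.\<close>

definition next_grid :: "nat \<Rightarrow> nat \<Rightarrow> nat \<Rightarrow> nat" where
  "next_grid \<mu> \<nu> n = (LEAST m. n \<le> m \<and> (\<mu> dvd m \<or> \<nu> dvd m))"

lemma next_grid: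
  assumes "\<mu> > 0"
  shows "n \<le> next_grid \<mu> \<nu> n" "\<mu> dvd next_grid \<mu> \<nu> n \<or> \<nu> dvd next_grid \<mu> \<nu> n"
proof -
  have "n \<le> n * \<mu> \<and> (\<mu> dvd n * \<mu> \<or> \<nu> dvd n * \<mu>)" using assms by simp
  from LeastI[of "\<lambda>m. n \<le> m \<and> (\<mu> dvd m \<or> \<nu> dvd m)", OF this]
  show "n \<le> next_grid \<mu> \<nu> n" "\<mu> dvd next_grid \<mu> \<nu> n \<or> \<nu> dvd next_grid \<mu> \<nu> n"
    by (auto simp: next_grid_def)
qed

lemma next_grid_le: "n \<le> m \<Longrightarrow> \<mu> dvd m \<or> \<nu> dvd m \<Longrightarrow> next_grid \<mu> \<nu> n \<le> m"
  by (simp add: next_grid_def Least_le)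

lemma next_grid_self: "\<mu> dvd n \<or> \<nu> dvd n \<Longrightarrow> next_grid \<mu> \<nu> n = n"
  unfolding next_grid_def by (rule Least_equality) auto

lemma next_grid_Suc:
  assumes "\<not> \<mu> dvd n" "\<not> \<nu> dvd n"
  shows "next_grid \<mu> \<nu> (Suc n) = next_grid \<mu> \<nu> n"
proof -
  have "Suc n \<le> m \<and> (\<mu> dvd m \<or> \<nu> dvd m) \<longleftrightarrow> n \<le> m \<and> (\<mu> dvd m \<or> \<nu> dvd m)" for m
    using assms by (cases "m = n") auto
  then show ?thesis by (simp add: next_grid_def)
qed

lemma joint_grid_real:
  "joint_grid (real \<mu>) (real \<nu>) = real ` {n. \<mu> dvd n \<or> \<nu> dvd n}"
  by (auto simp: joint_grid_def grid_real)

lemma joint_succ_real: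
  assumes "\<mu> > 0"
  shows "joint_succ (real \<mu>) (real \<nu>) (real n) = real (next_grid \<mu> \<nu> (Suc n))"
  unfolding joint_succ_def
proof (rule Least_equality)
  show "real (next_grid \<mu> \<nu> (Suc n)) \<in> joint_grid (real \<mu>) (real \<nu>) \<and>
      real n < real (next_grid \<mu> \<nu> (Suc n))"
    using next_grid[OF assms, where n = "Suc n" and \<nu> = \<nu>] by (auto simp: joint_grid_real)
  fix t assume "t \<in> joint_grid (real \<mu>) (real \<nu>) \<and> real n < t"
  then show "real (next_grid \<mu> \<nu> (Suc n)) \<le> t"
    using next_grid_le[of "Suc n" _ \<mu> \<nu>] by (auto simp: joint_grid_real)
qed

text \<open>Replaces the enumeration of a set of reals by a filtered interval, over which the
  evolution operator can be treated by induction on \<open>T\<close>.\<close>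

lemma sorted_list_of_joint_grid:
  "sorted_list_of_set (joint_grid (real \<mu>) (real \<nu>) \<inter> {0..<real T}) =
   map real (filter (\<lambda>n. \<mu> dvd n \<or> \<nu> dvd n) [0..<T])" (is "_ = ?l")
proof -
  have "sorted_list_of_set (set ?l) = ?l"
    by (intro sorted_list_of_set.idem_if_sorted_distinct)
      (simp_all add: sorted_map distinct_map sorted_wrt_filter)
  moreover have "set ?l = joint_grid (real \<mu>) (real \<nu>) \<inter> {0..<real T}"
    by (auto simp: joint_grid_real)
  ultimately show ?thesis
    by (simp only:)
qed

section \<open>Evolution of the state vector\<close>

text \<open>The state vector records the latest values of \<open>x\<close> and \<open>y\<close> in positions 0 and 2, and in
  positions 1 and 3 the values that each of them had at the latest grid point of the other. At
  common grid points the latter two are never read, so the invariant leaves them open.\<close>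

definition async_state ::
    "nat \<Rightarrow> nat \<Rightarrow> (nat \<Rightarrow> real) \<Rightarrow> (nat \<Rightarrow> real) \<Rightarrow> nat \<Rightarrow> real vec \<Rightarrow> bool" where
  "async_state \<mu> \<nu> X Y n v \<longleftrightarrow> v \<in> carrier_vec 4 \<and>
     v $ 0 = X (grid_floor_nat \<mu> n) \<and> v $ 2 = Y (grid_floor_nat \<nu> n) \<and>
     (\<mu> dvd n \<and> \<nu> dvd n \<or>
       v $ 1 = X (grid_floor_nat \<mu> (grid_floor_nat \<nu> n)) \<and>
       v $ 3 = Y (grid_floor_nat \<nu> (grid_floor_nat \<mu> n)))"

text \<open>The multiple of \<open>\<mu>\<close> following the current floor is itself a joint grid
  point, so the next joint grid point cannot lie beyond it and coincides with it exactly when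
  divisible by \<open>\<mu>\<close>.\<close>

lemma grid_floor_next:
  assumes "\<mu> > 0"
  shows "grid_floor_nat \<mu> (next_grid \<mu> \<nu> (Suc n)) =
    (if \<mu> dvd next_grid \<mu> \<nu> (Suc n) then grid_floor_nat \<mu> n + \<mu> else grid_floor_nat \<mu> n)"
proof -
  define m where "m = next_grid \<mu> \<nu> (Suc n)"
  define f where "f = grid_floor_nat \<mu> n"
  have f: "\<mu> dvd f" "f \<le> n" "n < f + \<mu>"
    using dvd_grid_floor_nat grid_floor_nat_le less_grid_floor_nat_add[OF assms] by (auto simp: f_def)
  have m: "n < m"
    using next_grid(1)[OF assms, of "Suc n" \<nu>] by (simp add: m_def)
  have le: "m \<le> f + \<mu>"
    unfolding m_def by (rule next_grid_le) (use f in auto)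
  have "grid_floor_nat \<mu> m = (if \<mu> dvd m then f + \<mu> else f)"
  proof (cases "\<mu> dvd m")
    case True
    then have "\<mu> dvd m - f" using f(1) by (rule dvd_diff_nat)
    then have "\<mu> \<le> m - f" using m f(2) by (intro dvd_imp_le) auto
    then have "m = f + \<mu>" using le m f(2) by linarith
    then show ?thesis using grid_floor_nat_eq[OF True] True by metis
  next
    case False
    then have "m \<noteq> f + \<mu>" using f(1) by auto
    then have "grid_floor_nat \<mu> m = f"
      using le m f by (intro grid_floor_nat_unique) auto
    then show ?thesis using False by simp
  qed
  then show ?thesis by (simp only: m_def f_def)
qed

lemma mat_of_rows_list_mult_vec:
  assumes "v \<in> carrier_vec n"
  shows "mat_of_rows_list n rs *\<^sub>v v = vec_of_list (map (\<lambda>r. \<Sum>j<n. r ! j * v $ j) rs)"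
  using assms
  by (intro eq_vecI)
    (auto simp: mat_of_rows_list_def scalar_prod_def vec_of_list_index lessThan_atLeast0)

lemma sum4: "(\<Sum>j<4. g j) = g 0 + g 1 + g 2 + g (3 :: nat)"
  by (simp add: eval_nat_numeral)

lemma mat4_mult_vec:
  fixes v :: "real vec"
  assumes "v \<in> carrier_vec 4"
  shows "mat_of_rows_list 4
      [[a00, a01, a02, a03], [a10, a11, a12, a13], [a20, a21, a22, a23], [a30, a31, a32, a33]] *\<^sub>v v =
    vec_of_list
      [a00 * v $ 0 + a01 * v $ 1 + a02 * v $ 2 + a03 * v $ 3,
       a10 * v $ 0 + a11 * v $ 1 + a12 * v $ 2 + a13 * v $ 3,
       a20 * v $ 0 + a21 * v $ 1 + a22 * v $ 2 + a23 * v $ 3,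
       a30 * v $ 0 + a31 * v $ 1 + a32 * v $ 2 + a33 * v $ 3]"
  unfolding mat_of_rows_list_mult_vec[OF assms] list.map sum4 by simp

lemma vec_of_list_4:
  "vec_of_list [a, b, c, d] \<in> carrier_vec 4"
  "vec_of_list [a, b, c, d] $ 0 = a" "vec_of_list [a, b, c, d] $ 1 = b"
  "vec_of_list [a, b, c, d] $ 2 = c" "vec_of_list [a, b, c, d] $ 3 = d"
  unfolding vec_of_list_index by (rule carrier_vecI) simp_all

text \<open>The four flags say whether the present point (\<open>p\<close>, \<open>q\<close>) and
  its successor (\<open>p'\<close>, \<open>q'\<close>) lie on the two grids; \<open>b\<close> and
  \<open>d\<close> are the delayed values of \<open>x\<close> and \<open>y\<close>. The first two
  hypotheses leave exactly the nine defined matrices. Those with \<open>p\<close> and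
  \<open>q\<close> both true have zero columns 1 and 3 (counted from 0), so open entries are never
  read, and \<open>b = a\<close>, \<open>d = c\<close> there.\<close>

lemma async_matrix_mult_vec:
  assumes pq: "p \<or> q" "p' \<or> q'"
    and v: "v \<in> carrier_vec 4" "v $ 0 = a" "v $ 2 = c" "p \<and> q \<or> v $ 1 = b \<and> v $ 3 = d"
      "p \<longrightarrow> d = c" "q \<longrightarrow> b = a"
    and w: "w = async_matrix \<mu> \<nu> \<alpha> \<beta> \<gamma> \<delta> p p' q q' *\<^sub>v v"
  shows "w \<in> carrier_vec 4 \<and>
    w $ 0 = (if p' then (1 + \<mu> * \<alpha>) * a + \<mu> * \<beta> * d else a) \<and>
    w $ 2 = (if q' then (1 + \<nu> * \<delta>) * c + \<nu> * \<gamma> * b else c) \<and>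
    (p' \<and> q' \<or> w $ 1 = (if q' then a else b) \<and> w $ 3 = (if p' then c else d))"
  using pq v(2-)
  by (cases p; cases q; cases p'; cases q')
    (simp_all only: w async_matrix.simps mat4_mult_vec[OF v(1)] vec_of_list_4 simp_thms if_True if_False
      mult_zero_left mult_1 add_0_left add_0_right)

lemma async_state_step:
  assumes pos: "\<mu> > 0" "\<nu> > 0"
    and X: "async_rec \<mu> \<nu> \<alpha> \<beta> X Y" and Y: "async_rec \<nu> \<mu> \<delta> \<gamma> Y X"
    and n: "\<mu> dvd n \<or> \<nu> dvd n" and v: "async_state \<mu> \<nu> X Y n v"
  shows "async_state \<mu> \<nu> X Y (next_grid \<mu> \<nu> (Suc n))
    (async_matrix_at (real \<mu>) (real \<nu>) \<alpha> \<beta> \<gamma> \<delta> (real n) *\<^sub>v v)"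
proof -
  define m where "m = next_grid \<mu> \<nu> (Suc n)"
  have m: "\<mu> dvd m \<or> \<nu> dvd m" using next_grid(2)[OF pos(1)] by (simp add: m_def)
  have comm: "next_grid \<nu> \<mu> (Suc n) = m" by (simp add: m_def next_grid_def disj_commute)
  note fl = grid_floor_next[OF pos(1), of \<nu> n, folded m_def]
    grid_floor_next[OF pos(2), of \<mu> n, unfolded comm]
  note eqs = async_rec_floor[OF X, of n] async_rec_floor[OF Y, of n]
  define a b c d where "a = X (grid_floor_nat \<mu> n)"
    and "b = X (grid_floor_nat \<mu> (grid_floor_nat \<nu> n))"
    and "c = Y (grid_floor_nat \<nu> n)"
    and "d = Y (grid_floor_nat \<nu> (grid_floor_nat \<mu> n))"
  note abcd = a_def b_def c_def d_def
  have v': "v \<in> carrier_vec 4" "v $ 0 = a" "v $ 2 = c"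
    "\<mu> dvd n \<and> \<nu> dvd n \<or> v $ 1 = b \<and> v $ 3 = d"
    using v by (auto simp: async_state_def abcd)
  have now: "\<mu> dvd n \<longrightarrow> d = c" "\<nu> dvd n \<longrightarrow> b = a"
    by (simp_all add: abcd grid_floor_nat_eq)
  have a': "X (grid_floor_nat \<mu> m) =
      (if \<mu> dvd m then (1 + real \<mu> * \<alpha>) * a + real \<mu> * \<beta> * d else a)"
    unfolding fl(1) using eqs(1) by (simp only: abcd split: if_split) simp
  have c': "Y (grid_floor_nat \<nu> m) =
      (if \<nu> dvd m then (1 + real \<nu> * \<delta>) * c + real \<nu> * \<gamma> * b else c)"
    unfolding fl(2) using eqs(2) by (simp only: abcd split: if_split) simp
  \<comment> \<open>If only \<open>\<nu>\<close> divides \<open>m\<close>, the outer floor still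
    sees \<open>X\<close> at its unmoved floor, which is \<open>a\<close>. If \<open>\<nu>\<close>
    does not divide \<open>m\<close>, the floor for \<open>\<nu>\<close> has not moved and
    \<open>b\<close> persists.\<close>
  have b': "\<mu> dvd m \<and> \<nu> dvd m \<or>
      X (grid_floor_nat \<mu> (grid_floor_nat \<nu> m)) = (if \<nu> dvd m then a else b)"
  proof (cases "\<nu> dvd m")
    case True
    then show ?thesis using a' by (simp only: grid_floor_nat_eq if_True if_False) simp
  qed (simp only: fl b_def if_False simp_thms)
  have d': "\<mu> dvd m \<and> \<nu> dvd m \<or>
      Y (grid_floor_nat \<nu> (grid_floor_nat \<mu> m)) = (if \<mu> dvd m then c else d)"
  proof (cases "\<mu> dvd m")
    case True
    then show ?thesis using c' by (simp only: grid_floor_nat_eq if_True if_False) simp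
  qed (simp only: fl d_def if_False simp_thms)
  note w = async_matrix_mult_vec[OF n m v' now refl,
      where \<mu> = "real \<mu>" and \<nu> = "real \<nu>" and \<alpha> = \<alpha> and \<beta> = \<beta> and \<gamma> = \<gamma> and \<delta> = \<delta>]
  show ?thesis
    unfolding m_def[symmetric] async_matrix_at_def joint_succ_real[OF pos(1)] real_mem_grid
      async_state_def a' c'
    using w b' d' by (cases "\<mu> dvd m \<and> \<nu> dvd m") (simp_all only: simp_thms)
qed

lemma async_matrix_at_carrier:
  assumes "\<mu> > 0" "\<mu> dvd n \<or> \<nu> dvd n"
  shows "async_matrix_at (real \<mu>) (real \<nu>) \<alpha> \<beta> \<gamma> \<delta> (real n) \<in> carrier_mat 4 4"
  unfolding async_matrix_at_def joint_succ_real[OF assms(1)] real_mem_grid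
  using assms(2) next_grid(2)[OF assms(1), of \<nu> "Suc n"]
  by (cases "\<mu> dvd n"; cases "\<nu> dvd n"; cases "\<mu> dvd next_grid \<mu> \<nu> (Suc n)";
      cases "\<nu> dvd next_grid \<mu> \<nu> (Suc n)")
    (auto simp: mat_of_rows_list_def)

text \<open>Multiplying the factors of all points below \<open>T\<close> carries the state to the
  first grid point at or after \<open>T\<close>; an off-grid \<open>T\<close> adds no factor and
  leaves that point unchanged. The zeros in the initial vector are admissible because 0 is a common
  grid point, where the invariant leaves positions 1 and 3 open.\<close>

lemma evolution_op_state:
  assumes pos: "\<mu> > 0" "\<nu> > 0"
    and X: "async_rec \<mu> \<nu> \<alpha> \<beta> X Y" and Y: "async_rec \<nu> \<mu> \<delta> \<gamma> Y X"
  defines "\<Phi> \<equiv> \<lambda>T. evolution_op (real \<mu>) (real \<nu>) \<alpha> \<beta> \<gamma> \<delta> (real T)"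
  shows "\<Phi> T \<in> carrier_mat 4 4 \<and>
    async_state \<mu> \<nu> X Y (next_grid \<mu> \<nu> T) (\<Phi> T *\<^sub>v vec_of_list [X 0, 0, Y 0, 0])"
  unfolding \<Phi>_def evolution_op_def sorted_list_of_joint_grid
proof (induction T)
  case 0
  have "async_state \<mu> \<nu> X Y (next_grid \<mu> \<nu> 0) (vec_of_list [X 0, 0, Y 0, 0])"
    unfolding async_state_def vec_of_list_4
    by (simp add: next_grid_self grid_floor_nat_def vec_of_list_4(1) del: vec_of_list_Cons)
  then show ?case
    using vec_of_list_4(1)[of "X 0" 0 "Y 0" 0] by (simp del: vec_of_list_Cons)
next
  case (Suc n)
  define v where "v = vec_of_list [X 0, 0, Y 0, 0]"
  have v: "v \<in> carrier_vec 4"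
    unfolding v_def by (rule vec_of_list_4)
  define P where "P = foldl (\<lambda>P t. async_matrix_at (real \<mu>) (real \<nu>) \<alpha> \<beta> \<gamma> \<delta> t * P) (1\<^sub>m 4)
    (map real (filter (\<lambda>n. \<mu> dvd n \<or> \<nu> dvd n) [0..<n]))"
  have P: "P \<in> carrier_mat 4 4" "async_state \<mu> \<nu> X Y (next_grid \<mu> \<nu> n) (P *\<^sub>v v)"
    using Suc by (simp_all only: P_def v_def)
  show ?case
  proof (cases "\<mu> dvd n \<or> \<nu> dvd n")
    case True
    define M where "M = async_matrix_at (real \<mu>) (real \<nu>) \<alpha> \<beta> \<gamma> \<delta> (real n)"
    have M: "M \<in> carrier_mat 4 4"
      unfolding M_def by (rule async_matrix_at_carrier[OF pos(1) True])
    have "async_state \<mu> \<nu> X Y (next_grid \<mu> \<nu> (Suc n)) (M *\<^sub>v (P *\<^sub>v v))"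
      using async_state_step[OF pos X Y True] P(2) unfolding next_grid_self[OF True] M_def .
    moreover have "M * P *\<^sub>v v = M *\<^sub>v (P *\<^sub>v v)"
      using M P(1) v by (rule assoc_mult_mat_vec)
    moreover have "foldl (\<lambda>P t. async_matrix_at (real \<mu>) (real \<nu>) \<alpha> \<beta> \<gamma> \<delta> t * P) (1\<^sub>m 4)
        (map real (filter (\<lambda>n. \<mu> dvd n \<or> \<nu> dvd n) [0..<Suc n])) = M * P"
      using True by (simp add: P_def M_def)
    ultimately show ?thesis
      using M P(1) by (simp only: v_def[symmetric]) simp
  next
    case False
    then show ?thesis using Suc by (simp add: next_grid_Suc)
  qed
qed

section \<open>Transport over one period\<close>

lemma solution_op_carrier: "solution_op \<mu> \<nu> \<alpha> \<beta> \<gamma> \<delta> T \<in> carrier_mat 2 2"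
  unfolding solution_op_def Let_def mat_of_rows_list_def by (rule carrier_matI) simp_all

text \<open>The zeros in the initial state suppress columns 1 and 3 of the evolution operator, and
  at a common multiple \<open>T\<close> the entries 0 and 2 of the final state are the values at
  \<open>T\<close> itself. Only the two-by-two submatrix remains.\<close>

lemma solution_op_mult_vec:
  assumes "\<mu> > 0" "\<nu> > 0" "\<mu> dvd T" "\<nu> dvd T"
    and "async_rec \<mu> \<nu> \<alpha> \<beta> X Y" "async_rec \<nu> \<mu> \<delta> \<gamma> Y X"
  shows "solution_op (real \<mu>) (real \<nu>) \<alpha> \<beta> \<gamma> \<delta> (real T) *\<^sub>v vec_of_list [X 0, Y 0] =
    vec_of_list [X T, Y T]"
proof -
  define \<Phi> where "\<Phi> = evolution_op (real \<mu>) (real \<nu>) \<alpha> \<beta> \<gamma> \<delta> (real T)"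
  define v where "v = vec_of_list [X 0, 0, Y 0, 0]"
  have \<Phi>: "\<Phi> \<in> carrier_mat 4 4" "(\<Phi> *\<^sub>v v) $ 0 = X T" "(\<Phi> *\<^sub>v v) $ 2 = Y T"
    using evolution_op_state[OF assms(1,2,5,6), of T] assms(3,4)
    by (simp_all add: \<Phi>_def v_def async_state_def next_grid_self grid_floor_nat_eq)
  have "(\<Phi> *\<^sub>v v) $ i = (\<Sum>j<4. \<Phi> $$ (i, j) * v $ j)" if "i < 4" for i
    using \<Phi>(1) that vec_of_list_4(1)[of "X 0" 0 "Y 0" 0, folded v_def]
    by (simp add: scalar_prod_def lessThan_atLeast0)
  then have "(\<Phi> *\<^sub>v v) $ i = \<Phi> $$ (i, 0) * X 0 + \<Phi> $$ (i, 2) * Y 0" if "i < 4" for i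
    using that unfolding sum4 v_def vec_of_list_4 by simp
  from this[of 0] this[of 2]
  have "\<Phi> $$ (0, 0) * X 0 + \<Phi> $$ (0, 2) * Y 0 = X T" "\<Phi> $$ (2, 0) * X 0 + \<Phi> $$ (2, 2) * Y 0 = Y T"
    using \<Phi>(2,3) by simp_all
  moreover have "vec_of_list [X 0, Y 0] \<in> carrier_vec 2"
    by (rule carrier_vecI) simp
  moreover have "(\<Sum>j<2. g j) = g 0 + g 1" for g :: "nat \<Rightarrow> real"
    by (simp add: eval_nat_numeral)
  ultimately show ?thesis
    unfolding solution_op_def Let_def \<Phi>_def[symmetric]
    by (simp only: mat_of_rows_list_mult_vec list.map vec_of_list_index nth_Cons_0 nth_Cons_Suc One_nat_def)
qed

section \<open>Convergence along the grids\<close>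

text \<open>The floor extends \<open>x\<close> from its grid to all natural times as a step
  function; at grid points it is the identity, so the limit restricts to the grid.\<close>

lemma grid_tendsto:
  assumes "\<rho> > 0" "(\<lambda>n. x (real (grid_floor_nat \<rho> n))) \<longlonglongrightarrow> l"
  shows "(x \<longlongrightarrow> l) (grid_at_top (real \<rho>))"
  unfolding tendsto_def grid_at_top_def eventually_inf_principal
proof (intro allI impI)
  fix S assume "open S" "l \<in> S"
  then obtain N where N: "\<And>n. n \<ge> N \<Longrightarrow> x (real (grid_floor_nat \<rho> n)) \<in> S"
    using assms(2) by (auto simp: tendsto_def eventually_sequentially)
  show "\<forall>\<^sub>F t in at_top. t \<in> grid (real \<rho>) \<longrightarrow> x t \<in> S"
    using eventually_ge_at_top[of "real N"]
  proof eventually_elim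
    case (elim t)
    show ?case
    proof
      assume "t \<in> grid (real \<rho>)"
      then obtain n where "t = real n" "\<rho> dvd n" by (auto simp: grid_real)
      then show "x t \<in> S" using N[of n] elim by (simp add: grid_floor_nat_eq)
    qed
  qed
qed

lemma async_rec_tendsto_zero:
  assumes pos: "\<mu> > 0" "\<nu> > 0" and T: "T > 0" "\<mu> dvd T" "\<nu> dvd T"
    and sp: "spectrum (map_mat complex_of_real
      (solution_op (real \<mu>) (real \<nu>) \<alpha> \<beta> \<gamma> \<delta> (real T))) \<subseteq> ball 0 1"
    and X: "async_rec \<mu> \<nu> \<alpha> \<beta> X Y" and Y: "async_rec \<nu> \<mu> \<delta> \<gamma> Y X"
  shows "(\<lambda>n. X (grid_floor_nat \<mu> n)) \<longlonglongrightarrow> 0" "(\<lambda>n. Y (grid_floor_nat \<nu> n)) \<longlonglongrightarrow> 0"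
proof -
  have dvd: "\<mu> dvd k * T" "\<nu> dvd k * T" for k using T by auto
  note shift = async_rec_shift[OF X dvd] async_rec_shift[OF Y dvd(2) dvd(1)]
  define u where "u k = vec_of_list [X (k * T), Y (k * T)]" for k
  have "u (Suc k) = solution_op (real \<mu>) (real \<nu>) \<alpha> \<beta> \<gamma> \<delta> (real T) *\<^sub>v u k" for k
    using solution_op_mult_vec[OF pos T(2,3) shift[of k]] by (simp add: u_def add.commute)
  moreover have "u k \<in> carrier_vec 2" for k
    unfolding u_def by (rule carrier_vecI) simp
  ultimately have lim: "(\<lambda>k. u k $ i) \<longlonglongrightarrow> 0" if "i < 2" for i
    using that by (intro linear_recurrence_tendsto_zero[OF solution_op_carrier sp])
  have "(\<lambda>k. \<bar>X (k * T)\<bar> + \<bar>Y (k * T)\<bar>) \<longlonglongrightarrow> \<bar>0\<bar> + \<bar>0\<bar>"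
    using lim[of 0] lim[of 1] by (intro tendsto_add tendsto_rabs)
      (simp_all only: u_def vec_of_list_index, simp_all)
  \<comment> \<open>\<open>n div T\<close> is the index of the period containing \<open>n\<close>;
    it carries the limit over periods to a limit over all times.\<close>
  moreover have "filterlim (\<lambda>n. n div T) sequentially sequentially"
    using T(1) by (rule filterlim_at_top_div_const_nat)
  ultimately have "(\<lambda>n. \<bar>X (n div T * T)\<bar> + \<bar>Y (n div T * T)\<bar>) \<longlonglongrightarrow> 0"
    using filterlim_compose[of "\<lambda>k. \<bar>X (k * T)\<bar> + \<bar>Y (k * T)\<bar>" "nhds 0" sequentially "\<lambda>n. n div T"]
    by simp
  from tendsto_mult_left[OF this]
  have lim0: "(\<lambda>n. C * (\<bar>X (n div T * T)\<bar> + \<bar>Y (n div T * T)\<bar>)) \<longlonglongrightarrow> 0" for C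
    by simp
  obtain C where C: "\<And>X Y s. async_rec \<mu> \<nu> \<alpha> \<beta> X Y \<Longrightarrow> async_rec \<nu> \<mu> \<delta> \<gamma> Y X \<Longrightarrow> s \<le> T \<Longrightarrow>
      \<bar>X (grid_floor_nat \<mu> s)\<bar> \<le> C * (\<bar>X 0\<bar> + \<bar>Y 0\<bar>) \<and>
      \<bar>Y (grid_floor_nat \<nu> s)\<bar> \<le> C * (\<bar>X 0\<bar> + \<bar>Y 0\<bar>)"
    using async_rec_bounded[OF pos, of \<alpha> \<beta> \<delta> \<gamma> T] by metis
  have bound: "\<bar>X (grid_floor_nat \<mu> n)\<bar> \<le> C * (\<bar>X (n div T * T)\<bar> + \<bar>Y (n div T * T)\<bar>)"
    "\<bar>Y (grid_floor_nat \<nu> n)\<bar> \<le> C * (\<bar>X (n div T * T)\<bar> + \<bar>Y (n div T * T)\<bar>)" for n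
  proof -
    \<comment> \<open>Splitting \<open>n\<close> at the start of its period reduces the bound to
      time \<open>n mod T\<close> of the translated solution, to which the uniform \<open>C\<close>
      applies.\<close>
    have "grid_floor_nat \<rho> n = n div T * T + grid_floor_nat \<rho> (n mod T)" if "\<rho> dvd T" for \<rho>
      using grid_floor_nat_add[of \<rho> "n div T * T" "n mod T"] that by simp
    then show "\<bar>X (grid_floor_nat \<mu> n)\<bar> \<le> C * (\<bar>X (n div T * T)\<bar> + \<bar>Y (n div T * T)\<bar>)"
      "\<bar>Y (grid_floor_nat \<nu> n)\<bar> \<le> C * (\<bar>X (n div T * T)\<bar> + \<bar>Y (n div T * T)\<bar>)"
      using C[OF shift[of "n div T"], of "n mod T"] T by (auto simp: less_imp_le)
  qed
  show "(\<lambda>n. X (grid_floor_nat \<mu> n)) \<longlonglongrightarrow> 0" "(\<lambda>n. Y (grid_floor_nat \<nu> n)) \<longlonglongrightarrow> 0"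
    by (rule tendsto_0_le[OF lim0[of C], where K = 1],
        use order_trans[OF bound(1) abs_ge_self] order_trans[OF bound(2) abs_ge_self]
        in \<open>auto intro!: always_eventually\<close>)+
qed

theorem theorem7p1:
  fixes \<mu> \<nu> :: nat and \<alpha> \<beta> \<gamma> \<delta> :: real
  assumes "\<mu> > 0" and "\<nu> > 0"
    and "spectrum (map_mat complex_of_real
           (solution_op (real \<mu>) (real \<nu>) \<alpha> \<beta> \<gamma> \<delta> (real (lcm \<mu> \<nu>)))) \<subseteq> ball 0 1"
  shows "zero_globally_asymptotically_stable (real \<mu>) (real \<nu>) \<alpha> \<beta> \<gamma> \<delta>"
proof -
  have "async_solution (real \<mu>) (real \<nu>) \<alpha> \<beta> \<gamma> \<delta> (\<lambda>_. 0) (\<lambda>_. 0)"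
    by (simp add: async_solution_def fdiff_def)
  moreover have "(x \<longlongrightarrow> 0) (grid_at_top (real \<mu>)) \<and> (y \<longlongrightarrow> 0) (grid_at_top (real \<nu>))"
    if "async_solution (real \<mu>) (real \<nu>) \<alpha> \<beta> \<gamma> \<delta> x y" for x y
  proof -
    have "lcm \<mu> \<nu> > 0" using assms by (simp add: lcm_pos_nat)
    then show ?thesis
      using async_rec_tendsto_zero[OF assms(1,2) _ dvd_lcm1 dvd_lcm2 assms(3)]
        that[unfolded async_solution_nat[OF assms(1,2)]] assms(1,2)
      by (auto intro!: grid_tendsto)
  qed
  ultimately show ?thesis by (simp add: zero_globally_asymptotically_stable_def)
qed

end
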